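(* Let $E,J,R\in\mathbb R^{n,n}$ with $J=-J^T$, $R=R^T\ge0$, $E=E^T\ge0$, and consider the linear time-invariant dHDAE system $E\dot z=(J-R)z$. Then there exists a real orthogonal matrix $Z\in\mathbb R^{n,n}$ such that, with $\check E=Z^TEZ$, $\check J=Z^TJZ$, $\check R=Z^TRZ$, $\check z=Z^Tz$, the system $\check E\dot{\check z}=(\check J-\check R)\check z$ is still a dHDAE and has the block form $$\check E=\begin{bmatrix}E_{11}&E_{12}&0&0&0\\ E_{21}&E_{22}&0&0&0\\0&0&0&0&0\\0&0&0&0&0\\0&0&0&0&0\end{bmatrix},\quad \check J-\check R=\begin{bmatrix}J_{11}-R_{11}&J_{12}-R_{12}&J_{13}-R_{13}&J_{14}&0\\ J_{21}-R_{21}&J_{22}-R_{22}&J_{23}-R_{23}&0&0\\ J_{31}-R_{31}&J_{32}-R_{32}&J_{33}-R_{33}&0&0\\ J_{41}&0&0&0&0\\0&0&0&0&0\end{bmatrix}$$ with block sizes $n_1,n_2,n_3,n_4,n_5$, $n_4=n_1$ (some blocks may be void), where $\begin{bmatrix}E_{11}&E_{12}\\ E_{21}&E_{22}\end{bmatrix}$ is symmetric positive definite, and the matrices $J_{33}-R_{33}$ and $J_{41}=-J_{14}^T$ are nonsingular.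
   Context: A linear time-invariant dHDAE (dissipative Hamiltonian differential-algebraic equation) is a system $E\dot z=(J-R)z$ with real square matrices satisfying $J=-J^T$, $R=R^T\ge0$, $E=E^T\ge0$. In the block form, $J_{ij}$ and $R_{ij}$ denote the blocks of $\check J=-\check J^T$ and $\check R=\check R^T$ respectively. *)

theory Defs
  imports Complex_Main "Jordan_Normal_Form.Matrix"
begin

definition psd_mat :: "real mat \<Rightarrow> bool" where
  "psd_mat A \<longleftrightarrow> square_mat A \<and> A = transpose_mat A \<and>
     (\<forall>x \<in> carrier_vec (dim_row A). 0 \<le> x \<bullet> (A *\<^sub>v x))"

(* A matrix with zero rows is positive definite. *)
definition pd_mat :: "real mat \<Rightarrow> bool" where
  "pd_mat A \<longleftrightarrow> square_mat A \<and> A = transpose_mat A \<and>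
     (\<forall>x \<in> carrier_vec (dim_row A). x \<noteq> 0\<^sub>v (dim_row A) \<longrightarrow> 0 < x \<bullet> (A *\<^sub>v x))"

(* Orthogonal in the usual sense of orthonormal columns; the predicate orthogonal_mat of
   Jordan_Normal_Form.Matrix only asks for pairwise orthogonal nonzero columns. *)
definition real_orthogonal_mat :: "nat \<Rightarrow> real mat \<Rightarrow> bool" where
  "real_orthogonal_mat n Z \<longleftrightarrow> Z \<in> carrier_mat n n \<and>
     transpose_mat Z * Z = 1\<^sub>m n \<and> Z * transpose_mat Z = 1\<^sub>m n"

definition dHDAE :: "nat \<Rightarrow> real mat \<Rightarrow> real mat \<Rightarrow> real mat \<Rightarrow> bool" where
  "dHDAE n E J R \<longleftrightarrow>
     E \<in> carrier_mat n n \<and> J \<in> carrier_mat n n \<and> R \<in> carrier_mat n n \<and>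
     J = - transpose_mat J \<and> psd_mat R \<and> psd_mat E"

(* z solves E z' = (J - R) z on the time domain T. The derivative is taken componentwise because
   the type of vectors of arbitrary dimension is not a normed space. *)
definition dHDAE_solution ::
  "nat \<Rightarrow> real mat \<Rightarrow> real mat \<Rightarrow> real mat \<Rightarrow> real set \<Rightarrow> (real \<Rightarrow> real vec) \<Rightarrow> bool" where
  "dHDAE_solution n E J R T z \<longleftrightarrow>
     (\<forall>t\<in>T. z t \<in> carrier_vec n \<and>
        (\<exists>dz \<in> carrier_vec n.
           (\<forall>i<n. ((\<lambda>s. z s $ i) has_real_derivative dz $ i) (at t within T)) \<and>
           E *\<^sub>v dz = (J - R) *\<^sub>v z t))"

(* The block in block row i and block column j, counted from 1, of a square matrix whose rows and
   columns are both partitioned into consecutive groups with the sizes listed in ns. *)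
definition blk :: "nat list \<Rightarrow> 'a mat \<Rightarrow> nat \<Rightarrow> nat \<Rightarrow> 'a mat" where
  "blk ns A i j = mat (ns ! (i - 1)) (ns ! (j - 1))
     (\<lambda>(a, b). A $$ (sum_list (take (i - 1) ns) + a, sum_list (take (j - 1) ns) + b))"

fun hcat :: "'a::zero mat list \<Rightarrow> 'a mat" where
  "hcat [] = 0\<^sub>m 0 0"
| "hcat [A] = A"
| "hcat (A # B # As) =
     (let C = hcat (B # As) in four_block_mat A C (0\<^sub>m 0 (dim_col A)) (0\<^sub>m 0 (dim_col C)))"

fun vcat :: "'a::zero mat list \<Rightarrow> 'a mat" where
  "vcat [] = 0\<^sub>m 0 0"
| "vcat [A] = A"
| "vcat (A # B # As) = A @\<^sub>r vcat (B # As)"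

(* The matrix assembled from a list of block rows; blocks with no rows or no columns are allowed. *)
definition block_mat :: "'a::zero mat list list \<Rightarrow> 'a mat" where
  "block_mat Bs = vcat (map hcat Bs)"

end

theory Submission
  imports Defs "Jordan_Normal_Form.Matrix_Kernel"
begin

text \<open>
  The orthogonal matrix \<open>Z\<close> has as columns an orthonormal basis of \<open>\<real>\<^sup>n\<close> that is adapted to a chain of
  subspaces read off from \<open>E\<close>, \<open>J\<close> and \<open>R\<close>. Let \<open>N\<close> be the kernel of \<open>E\<close> and \<open>W\<close> its orthogonal
  complement, on which \<open>E\<close> is positive definite. Let \<open>K\<close> consist of the \<open>x \<in> N\<close> with \<open>R x = 0\<close> and
  \<open>J x \<in> W\<close>, and let \<open>L\<close> be the set of \<open>x \<in> K\<close> with \<open>J x = 0\<close>. The last three groups of basis vectors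
  \<open>c3\<close>, \<open>c4\<close>, \<open>c5\<close> span \<open>N\<close>, with \<open>c5\<close> a basis of \<open>L\<close> and \<open>c4 @ c5\<close> a basis of \<open>K\<close>. Since \<open>J K\<close> lies in
  \<open>W\<close>, the first two groups can be chosen so that \<open>c1\<close> is a basis of \<open>J K\<close> and \<open>c1 @ c2\<close> one of \<open>W\<close>.

  The zero blocks are then immediate. \<open>E\<close> annihilates \<open>c3\<close>, \<open>c4\<close>, \<open>c5\<close>, \<open>R\<close> annihilates \<open>c4\<close>, \<open>c5\<close>, \<open>J\<close>
  annihilates \<open>c5\<close>, and \<open>J\<close> maps \<open>c4\<close> into the span of \<open>c1\<close>; symmetry and skew-symmetry give the
  transposed blocks. \<open>J\<close> maps \<open>K\<close> onto \<open>J K\<close> with kernel \<open>L\<close>, hence the span of \<open>c4\<close> bijectively onto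
  that of \<open>c1\<close>; so \<open>n4 = n1\<close> and the block \<open>(4, 1)\<close> is invertible. Finally let \<open>y\<close> be in the span of
  \<open>c3\<close> and in the kernel of the block \<open>(3, 3)\<close>. Then \<open>0 = y \<bullet> (J - R) y = - (y \<bullet> R y)\<close>, which
  forces \<open>R y = 0\<close> because \<open>R\<close> is semidefinite (\<open>psd_mat_quadratic_form_eq_0\<close>). So \<open>J y\<close> is orthogonal
  to \<open>c3\<close>, and by skew-symmetry also to \<open>K\<close>; thus \<open>y \<in> K\<close>, and \<open>y\<close> vanishes, being orthogonal to \<open>K\<close>.

  The basis is constructed in \<open>dHDAE_adapted_basis\<close>. Orthonormal bases of subspaces exist, and extend
  to larger subspaces, because orthonormal lists have length at most \<open>n\<close> and one of maximal length in a
  subspace is complete (\<open>orthonormal_basis_extend\<close>). By \<open>blk_compression\<close> the blocks of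
  \<open>Z\<^sup>T A Z\<close> are the matrices of inner products \<open>u \<bullet> A v\<close> with \<open>u\<close> and \<open>v\<close> in two of the five groups.
\<close>

section \<open>Subspaces and orthonormal lists\<close>

text \<open>Linear subspaces of \<open>\<real>\<^sup>n\<close>. The scalars form a field, so the submodules of \<open>\<real>\<^sup>n\<close> are its
  subspaces.\<close>

abbreviation vec_subspace :: "nat \<Rightarrow> real vec set \<Rightarrow> bool" where
  "vec_subspace n S \<equiv> submodule class_ring S (module_vec TYPE(real) n)"

lemma vec_subspaceI:
  assumes "S \<subseteq> carrier_vec n" "0\<^sub>v n \<in> S"
    "\<And>x y. x \<in> S \<Longrightarrow> y \<in> S \<Longrightarrow> x + y \<in> S" "\<And>a x. x \<in> S \<Longrightarrow> a \<cdot>\<^sub>v x \<in> S"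
  shows "vec_subspace n S"
proof -
  interpret vec_space "TYPE(real)" n .
  show ?thesis
    by (unfold_locales) (use assms in \<open>auto simp: module_vec_simps class_ring_simps\<close>)
qed

lemma vec_subspaceD:
  assumes "vec_subspace n S"
  shows "S \<subseteq> carrier_vec n" "0\<^sub>v n \<in> S"
    "\<And>x y. x \<in> S \<Longrightarrow> y \<in> S \<Longrightarrow> x + y \<in> S" "\<And>a x. x \<in> S \<Longrightarrow> a \<cdot>\<^sub>v x \<in> S"
proof -
  interpret submodule class_ring S "module_vec TYPE(real) n" by fact
  show "S \<subseteq> carrier_vec n" "0\<^sub>v n \<in> S"
    "\<And>x y. x \<in> S \<Longrightarrow> y \<in> S \<Longrightarrow> x + y \<in> S" "\<And>a x. x \<in> S \<Longrightarrow> a \<cdot>\<^sub>v x \<in> S"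
    using subset zero_closed m_closed smult_closed by (auto simp: module_vec_simps class_ring_simps)
qed

lemma vec_subspace_minus:
  assumes "vec_subspace n S" "x \<in> S" "y \<in> S"
  shows "x - y \<in> S"
proof -
  have "x + (-1) \<cdot>\<^sub>v y \<in> S" using vec_subspaceD[OF assms(1)] assms by blast
  moreover have "x + (-1) \<cdot>\<^sub>v y = x - y"
    using vec_subspaceD(1)[OF assms(1)] assms by (intro eq_vecI) auto
  ultimately show ?thesis by simp
qed

lemma vec_subspace_mat_of_cols_mult:
  assumes S: "vec_subspace n S" and cs: "set cs \<subseteq> S" and x: "x \<in> carrier_vec (length cs)"
  shows "mat_of_cols n cs *\<^sub>v x \<in> S"
proof -
  interpret vec_space "TYPE(real)" n .
  have c: "set cs \<subseteq> carrier_vec n" using vec_subspaceD(1)[OF S] cs by auto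
  have "x = vec (length cs) (\<lambda>i. x $ i)" using x by auto
  then have "mat_of_cols n cs *\<^sub>v x = lincomb_list (\<lambda>i. x $ i) cs"
    using lincomb_list_as_mat_mult[of cs "\<lambda>i. x $ i"] c by (metis carrier_vecD subsetD)
  also have "\<dots> \<in> span_list cs" unfolding span_list_def by auto
  also have "span_list cs = span (set cs)" by (rule span_list_as_span[OF c])
  also have "\<dots> \<subseteq> S" by (rule span_is_subset[OF cs S])
  finally show ?thesis .
qed

lemma vec_subspace_inter:
  "vec_subspace n S \<Longrightarrow> vec_subspace n T \<Longrightarrow> vec_subspace n (S \<inter> T)"
  by (rule vec_subspaceI) (auto dest: vec_subspaceD)

lemma vec_subspace_preimage:
  assumes "A \<in> carrier_mat m n" "vec_subspace m S"
  shows "vec_subspace n {x \<in> carrier_vec n. A *\<^sub>v x \<in> S}"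
proof -
  have "A *\<^sub>v 0\<^sub>v n = 0\<^sub>v m" using assms(1) by auto
  then show ?thesis
    using vec_subspaceD[OF assms(2)] assms(1)
    by (intro vec_subspaceI) (auto simp: mult_add_distrib_mat_vec mult_mat_vec)
qed

lemma vec_subspace_image:
  assumes "A \<in> carrier_mat m n" "vec_subspace n S"
  shows "vec_subspace m ((*\<^sub>v) A ` S)"
proof (rule vec_subspaceI)
  note S = vec_subspaceD[OF assms(2)]
  show "(*\<^sub>v) A ` S \<subseteq> carrier_vec m" using S(1) assms(1) by auto
  have "A *\<^sub>v 0\<^sub>v n = 0\<^sub>v m" using assms(1) by auto
  then show "0\<^sub>v m \<in> (*\<^sub>v) A ` S" using S(2) by (metis imageI)
  show "x + y \<in> (*\<^sub>v) A ` S" if "x \<in> (*\<^sub>v) A ` S" "y \<in> (*\<^sub>v) A ` S" for x y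
  proof -
    from that obtain u v where "u \<in> S" "v \<in> S" "x = A *\<^sub>v u" "y = A *\<^sub>v v" by auto
    then have "x + y = A *\<^sub>v (u + v)" "u + v \<in> S"
      using S mult_add_distrib_mat_vec[OF assms(1), of u v] by (auto simp: subset_iff)
    then show ?thesis by blast
  qed
  show "a \<cdot>\<^sub>v x \<in> (*\<^sub>v) A ` S" if "x \<in> (*\<^sub>v) A ` S" for a x
  proof -
    from that obtain u where "u \<in> S" "x = A *\<^sub>v u" by auto
    then have "a \<cdot>\<^sub>v x = A *\<^sub>v (a \<cdot>\<^sub>v u)" "a \<cdot>\<^sub>v u \<in> S"
      using S mult_mat_vec[OF assms(1), of u a] by (auto simp: subset_iff)
    then show ?thesis by blast
  qed
qed

lemma vec_subspace_mat_kernel: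
  assumes "A \<in> carrier_mat m n"
  shows "vec_subspace n (mat_kernel A)"
  unfolding mat_kernel[OF assms] using assms
  by (intro vec_subspaceI) (auto simp: mult_add_distrib_mat_vec mult_mat_vec)

abbreviation ortho_compl :: "nat \<Rightarrow> real vec set \<Rightarrow> real vec set" where
  "ortho_compl \<equiv> vec_module.orthogonal_complement"

lemma ortho_compl_iff:
  "x \<in> ortho_compl n S \<longleftrightarrow> x \<in> carrier_vec n \<and> (\<forall>y\<in>S. x \<bullet> y = 0)"
  by (simp add: vec_module.orthogonal_complement_def)

lemma vec_subspace_ortho_compl:
  assumes "S \<subseteq> carrier_vec n"
  shows "vec_subspace n (ortho_compl n S)"
  using assms
  by (intro vec_subspaceI) (auto simp: ortho_compl_iff add_scalar_prod_distrib[where n=n] subset_iff)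

text \<open>Orthonormality is stated on the set of entries of a list, together with distinctness, so that it
  is visibly invariant under permutations.\<close>

definition orthonormal :: "nat \<Rightarrow> real vec list \<Rightarrow> bool" where
  "orthonormal n cs \<longleftrightarrow> distinct cs \<and> set cs \<subseteq> carrier_vec n \<and>
     (\<forall>u\<in>set cs. \<forall>v\<in>set cs. u \<bullet> v = (if u = v then 1 else 0))"

lemma orthonormal_append:
  "orthonormal n (us @ vs) \<longleftrightarrow>
     orthonormal n us \<and> orthonormal n vs \<and> (\<forall>u\<in>set us. \<forall>v\<in>set vs. u \<bullet> v = 0)"
  (is "?L \<longleftrightarrow> ?R")
proof
  assume ?L
  then show ?R unfolding orthonormal_def by (auto; metis IntI empty_iff)
next
  assume R: ?R
  have sym: "v \<bullet> u = 0" if "u \<in> set us" "v \<in> set vs" for u v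
    using R that comm_scalar_prod[of u n v] unfolding orthonormal_def by (metis subsetD)
  have "set us \<inter> set vs = {}"
    using R unfolding orthonormal_def by (metis disjoint_iff zero_neq_one)
  then show ?L using R sym unfolding orthonormal_def by auto
qed

lemma transpose_mat_of_cols_mult_vec:
  assumes "set cs \<subseteq> carrier_vec n"
  shows "transpose_mat (mat_of_cols n cs) *\<^sub>v v = vec (length cs) (\<lambda>i. cs ! i \<bullet> v)"
proof (rule eq_vecI)
  fix i assume "i < dim_vec (vec (length cs) (\<lambda>i. cs ! i \<bullet> v))"
  then show "(transpose_mat (mat_of_cols n cs) *\<^sub>v v) $ i = vec (length cs) (\<lambda>i. cs ! i \<bullet> v) $ i"
    using assms by (simp add: subset_iff)
qed simp

lemma orthonormal_transpose_mult:
  assumes "orthonormal n cs"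
  shows "transpose_mat (mat_of_cols n cs) * mat_of_cols n cs = 1\<^sub>m (length cs)"
proof (rule eq_matI)
  fix i j assume "i < dim_row (1\<^sub>m (length cs))" "j < dim_col (1\<^sub>m (length cs))"
  moreover from this have "cs ! i \<in> carrier_vec n" "cs ! j \<in> carrier_vec n"
    using assms unfolding orthonormal_def by auto
  ultimately show "(transpose_mat (mat_of_cols n cs) * mat_of_cols n cs) $$ (i, j) = 1\<^sub>m (length cs) $$ (i, j)"
    using assms by (auto simp: orthonormal_def nth_eq_iff_index_eq)
qed auto

text \<open>A matrix with more columns than rows has a nontrivial kernel: pad it with zero rows to a
  square matrix of determinant zero.\<close>

lemma wide_mat_kernel_nontrivial:
  fixes A :: "real mat"
  assumes A: "A \<in> carrier_mat m n" and "m < n"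
  obtains v where "v \<in> carrier_vec n" "v \<noteq> 0\<^sub>v n" "A *\<^sub>v v = 0\<^sub>v m"
proof -
  define B where "B = A @\<^sub>r 0\<^sub>m (n - m) n"
  have B: "B \<in> carrier_mat n n"
    using carrier_append_rows[OF A, of "0\<^sub>m (n - m) n" "n - m"] \<open>m < n\<close> by (simp add: B_def)
  have "row B (n - 1) = 0\<^sub>v n"
    using A \<open>m < n\<close> by (intro eq_vecI) (auto simp: B_def append_rows_def)
  then have "transpose_mat B *\<^sub>v unit_vec n (n - 1) = 0\<^sub>v n"
    using B \<open>m < n\<close> by (intro eq_vecI) (auto simp: vec_eq_iff)
  moreover have "unit_vec n (n - 1) \<noteq> (0\<^sub>v n :: real vec)" using \<open>m < n\<close> by simp
  ultimately have "det (transpose_mat B) = 0"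
    using B det_0_iff_vec_prod_zero_field[of "transpose_mat B" n]
    by (metis transpose_carrier_mat unit_vec_carrier)
  then have "det B = 0" using det_transpose[OF B] by simp
  then obtain v where v: "v \<in> carrier_vec n" "v \<noteq> 0\<^sub>v n" "B *\<^sub>v v = 0\<^sub>v n"
    using det_0_iff_vec_prod_zero_field[OF B] by auto
  have "(A *\<^sub>v v) @\<^sub>v (0\<^sub>m (n - m) n *\<^sub>v v) = 0\<^sub>v n"
    using mat_mult_append[OF A _ v(1), of "0\<^sub>m (n - m) n" "n - m"] v(3) by (simp add: B_def)
  then have "((A *\<^sub>v v) @\<^sub>v (0\<^sub>m (n - m) n *\<^sub>v v)) $ i = 0" if "i < m" for i
    using that \<open>m < n\<close> by simp
  then have "A *\<^sub>v v = 0\<^sub>v m" using A v(1) \<open>m < n\<close> by (intro eq_vecI) auto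
  with v that show thesis by blast
qed

lemma orthonormal_length_le:
  assumes "orthonormal n cs"
  shows "length cs \<le> n"
proof (rule ccontr)
  let ?M = "mat_of_cols n cs"
  assume "\<not> length cs \<le> n"
  then obtain v where v: "v \<in> carrier_vec (length cs)" "v \<noteq> 0\<^sub>v (length cs)" "?M *\<^sub>v v = 0\<^sub>v n"
    using wide_mat_kernel_nontrivial[of ?M n "length cs"] by auto
  have "v = (transpose_mat ?M * ?M) *\<^sub>v v" using orthonormal_transpose_mult[OF assms] v by simp
  also have "\<dots> = transpose_mat ?M *\<^sub>v (?M *\<^sub>v v)"
    by (rule assoc_mult_mat_vec) (use v in auto)
  also have "\<dots> = 0\<^sub>v (length cs)" unfolding v(3) by auto
  finally show False using v(2) by simp
qed

text \<open>An orthonormal list in a subspace \<open>S\<close> that is complete: no nonzero vector of \<open>S\<close> is orthogonal to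
  all entries. That such a list spans \<open>S\<close> is \<open>orthonormal_basis_expansion\<close>.\<close>

definition orthonormal_basis :: "nat \<Rightarrow> real vec set \<Rightarrow> real vec list \<Rightarrow> bool" where
  "orthonormal_basis n S cs \<longleftrightarrow> orthonormal n cs \<and> set cs \<subseteq> S \<and>
     (\<forall>x\<in>S. (\<forall>c\<in>set cs. c \<bullet> x = 0) \<longrightarrow> x = 0\<^sub>v n)"

lemma scalar_prod_self_pos:
  fixes x :: "real vec"
  assumes "x \<in> carrier_vec n" "x \<noteq> 0\<^sub>v n"
  shows "0 < x \<bullet> x"
  using conjugate_square_greater_0_vec[OF assms(1)] assms(2) by auto

lemma orthonormal_basis_extend:
  assumes S: "vec_subspace n S" and us: "orthonormal n us" "set us \<subseteq> S"
  obtains vs where "orthonormal_basis n S (us @ vs)"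
proof -
  \<comment> \<open>Take a longest extension; a nonzero vector orthogonal to it could be normalized and appended.\<close>
  let ?P = "\<lambda>vs. orthonormal n (us @ vs) \<and> set vs \<subseteq> S"
  have "?P []" using us by simp
  moreover have "\<forall>vs. ?P vs \<longrightarrow> length vs < Suc n" using orthonormal_length_le by fastforce
  ultimately obtain vs where vs: "?P vs" and max: "\<And>ws. ?P ws \<Longrightarrow> length ws \<le> length vs"
    using ex_has_greatest_nat[of ?P "[]" length "Suc n"] by blast
  have "x = 0\<^sub>v n" if x: "x \<in> S" and orth: "\<forall>c\<in>set (us @ vs). c \<bullet> x = 0" for x
  proof (rule ccontr)
    assume "x \<noteq> 0\<^sub>v n"
    have xc: "x \<in> carrier_vec n" using x vec_subspaceD(1)[OF S] by auto
    then have pos: "0 < x \<bullet> x" using scalar_prod_self_pos \<open>x \<noteq> 0\<^sub>v n\<close> by blast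
    define u where "u = (1 / sqrt (x \<bullet> x)) \<cdot>\<^sub>v x"
    have "u \<bullet> u = 1" using xc pos by (simp add: u_def)
    then have "orthonormal n [u]" using xc by (simp add: orthonormal_def u_def)
    moreover have "\<forall>c\<in>set (us @ vs). c \<bullet> u = 0"
      using orth xc vs unfolding u_def orthonormal_def by auto
    ultimately have "?P (vs @ [u])"
      using vs vec_subspaceD(4)[OF S x] orthonormal_append[of n "us @ vs" "[u]"] by (auto simp: u_def)
    from max[OF this] show False by simp
  qed
  then have "orthonormal_basis n S (us @ vs)"
    using us vs unfolding orthonormal_basis_def by auto
  then show thesis by (rule that)
qed

lemma orthonormal_basis_expansion:
  assumes S: "vec_subspace n S" and cs: "orthonormal_basis n S cs" and x: "x \<in> S"
  shows "x = mat_of_cols n cs *\<^sub>v (transpose_mat (mat_of_cols n cs) *\<^sub>v x)"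
proof -
  let ?M = "mat_of_cols n cs" and ?Mt = "transpose_mat (mat_of_cols n cs)"
  have c: "set cs \<subseteq> carrier_vec n" "x \<in> carrier_vec n" and on: "orthonormal n cs"
    using vec_subspaceD(1)[OF S] cs x by (auto simp: orthonormal_basis_def)
  have tx: "?Mt *\<^sub>v x \<in> carrier_vec (length cs)"
    using c by (intro mult_mat_vec_carrier[where n=n]) auto
  define y where "y = x - ?M *\<^sub>v (?Mt *\<^sub>v x)"
  have px: "?M *\<^sub>v (?Mt *\<^sub>v x) \<in> carrier_vec n"
    by (rule mult_mat_vec_carrier[OF _ tx]) simp
  have "?M *\<^sub>v (?Mt *\<^sub>v x) \<in> S"
    using vec_subspace_mat_of_cols_mult[OF S _ tx] cs by (auto simp: orthonormal_basis_def)
  then have yS: "y \<in> S" unfolding y_def by (rule vec_subspace_minus[OF S x])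
  have "?Mt *\<^sub>v (?M *\<^sub>v (?Mt *\<^sub>v x)) = (?Mt * ?M) *\<^sub>v (?Mt *\<^sub>v x)"
    by (rule assoc_mult_mat_vec[symmetric]) (use tx in auto)
  also have "\<dots> = ?Mt *\<^sub>v x" using tx orthonormal_transpose_mult[OF on] by simp
  finally have "?Mt *\<^sub>v y = 0\<^sub>v (length cs)"
    unfolding y_def using tx mult_minus_distrib_mat_vec[of ?Mt "length cs" n, OF _ c(2) px] by simp
  then have "vec (length cs) (\<lambda>i. cs ! i \<bullet> y) = 0\<^sub>v (length cs)"
    unfolding transpose_mat_of_cols_mult_vec[OF c(1)] .
  then have "\<forall>i<length cs. cs ! i \<bullet> y = 0" by (metis index_vec index_zero_vec(1))
  then have "y = 0\<^sub>v n" using cs yS unfolding orthonormal_basis_def by (auto simp: all_set_conv_all_nth)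
  then have "y $ i = 0" if "i < n" for i using that by simp
  then show ?thesis unfolding y_def using c px by (intro eq_vecI) auto
qed

text \<open>A vector orthogonal to an orthonormal basis of a subspace is orthogonal to the subspace.\<close>

lemma orthonormal_basis_ortho:
  assumes S: "vec_subspace n S" and cs: "orthonormal_basis n S cs"
    and y: "y \<in> carrier_vec n" "\<And>c. c \<in> set cs \<Longrightarrow> c \<bullet> y = 0"
  shows "y \<in> ortho_compl n S"
  unfolding ortho_compl_iff
proof (intro conjI ballI)
  fix x assume x: "x \<in> S"
  let ?M = "mat_of_cols n cs" and ?Mt = "transpose_mat (mat_of_cols n cs)"
  have c: "set cs \<subseteq> carrier_vec n" "x \<in> carrier_vec n"
    using vec_subspaceD(1)[OF S] cs x by (auto simp: orthonormal_basis_def)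
  have tx: "?Mt *\<^sub>v x \<in> carrier_vec (length cs)"
    using c by (intro mult_mat_vec_carrier[where n=n]) auto
  have "?Mt *\<^sub>v y = 0\<^sub>v (length cs)"
    unfolding transpose_mat_of_cols_mult_vec[OF c(1)] using y(2) by (intro eq_vecI) auto
  then have "(?Mt *\<^sub>v y) \<bullet> (?Mt *\<^sub>v x) = 0" using tx by simp
  moreover have "(?Mt *\<^sub>v y) \<bullet> (?Mt *\<^sub>v x) = y \<bullet> (?M *\<^sub>v (?Mt *\<^sub>v x))"
    using transpose_vec_mult_scalar[of ?M n "length cs" _ y] tx y(1) by simp
  ultimately show "y \<bullet> x = 0" using orthonormal_basis_expansion[OF S cs x] by simp
qed (fact y)

section \<open>Symmetric, skew-symmetric and semidefinite matrices\<close>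

lemma scalar_prod_mult_mat_vec:
  fixes A :: "real mat"
  assumes "A \<in> carrier_mat m n" "x \<in> carrier_vec m" "y \<in> carrier_vec n"
  shows "x \<bullet> (A *\<^sub>v y) = (transpose_mat A *\<^sub>v x) \<bullet> y"
  using transpose_vec_mult_scalar[OF assms(1,3,2)] by simp

lemma skew_scalar_prod:
  fixes J :: "real mat"
  assumes J: "J \<in> carrier_mat n n" "J = - transpose_mat J"
    and x: "x \<in> carrier_vec n" and y: "y \<in> carrier_vec n"
  shows "x \<bullet> (J *\<^sub>v y) = - (y \<bullet> (J *\<^sub>v x))"
proof -
  have "transpose_mat J = - J" using J(2) by (metis transpose_transpose transpose_uminus)
  then have "x \<bullet> (J *\<^sub>v y) = (- J *\<^sub>v x) \<bullet> y"
    using scalar_prod_mult_mat_vec[OF J(1) x y] by simp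
  also have "\<dots> = - ((J *\<^sub>v x) \<bullet> y)" using J(1) x y by simp
  also have "(J *\<^sub>v x) \<bullet> y = y \<bullet> (J *\<^sub>v x)"
    using comm_scalar_prod[OF _ y, of "J *\<^sub>v x"] J(1) x by auto
  finally show ?thesis .
qed

text \<open>A semidefinite matrix \<open>A\<close> annihilates every vector \<open>x\<close> with \<open>x \<bullet> A x = 0\<close>: otherwise a small step
  from \<open>x\<close> in the direction of \<open>- A x\<close> would make the quadratic form negative.\<close>

lemma psd_mat_quadratic_form_eq_0:
  assumes A: "psd_mat A" "A \<in> carrier_mat n n" and x: "x \<in> carrier_vec n" "x \<bullet> (A *\<^sub>v x) = 0"
  shows "A *\<^sub>v x = 0\<^sub>v n"
proof (rule ccontr)
  define w where "w = A *\<^sub>v x"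
  assume "A *\<^sub>v x \<noteq> 0\<^sub>v n"
  have w: "w \<in> carrier_vec n" using A(2) x(1) by (simp add: w_def)
  \<comment> \<open>Along \<open>x + t w\<close> the form is \<open>2 t a + t\<^sup>2 b\<close>; adding \<open>1\<close> in the denominator of \<open>t\<close> covers \<open>b = 0\<close>.\<close>
  define a b t where "a = w \<bullet> w" and "b = w \<bullet> (A *\<^sub>v w)" and "t = - a / (b + 1)"
  have a: "a > 0" using scalar_prod_self_pos[OF w] \<open>A *\<^sub>v x \<noteq> 0\<^sub>v n\<close> by (simp add: w_def a_def)
  have b: "b \<ge> 0" using A w by (auto simp: psd_mat_def b_def)
  have Aw: "A *\<^sub>v w \<in> carrier_vec n" using A(2) w by simp
  have "x \<bullet> (A *\<^sub>v w) = a"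
    using scalar_prod_mult_mat_vec[OF A(2) x(1) w] A(1) by (simp add: psd_mat_def a_def w_def)
  moreover have "A *\<^sub>v (x + t \<cdot>\<^sub>v w) = w + t \<cdot>\<^sub>v (A *\<^sub>v w)"
    using A(2) x(1) w by (simp add: mult_add_distrib_mat_vec mult_mat_vec w_def)
  moreover have "x \<bullet> w = 0" using x(2) by (simp add: w_def)
  ultimately have "(x + t \<cdot>\<^sub>v w) \<bullet> (A *\<^sub>v (x + t \<cdot>\<^sub>v w)) = 2 * t * a + t\<^sup>2 * b"
    using x(1) w Aw
    by (simp add: add_scalar_prod_distrib[where n=n] scalar_prod_add_distrib[where n=n]
        a_def b_def power2_eq_square algebra_simps)
  moreover have "0 \<le> (x + t \<cdot>\<^sub>v w) \<bullet> (A *\<^sub>v (x + t \<cdot>\<^sub>v w))"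
    using A x(1) w by (auto simp: psd_mat_def)
  ultimately have "0 \<le> 2 * t * a + t\<^sup>2 * b" by simp
  also have "\<dots> = t * (2 * a + t * b)" by (simp add: power2_eq_square algebra_simps)
  also have "t * b = - a - t" using b by (simp add: t_def field_simps)
  also have "t * (2 * a + (- a - t)) = t * a - t\<^sup>2" by (simp add: power2_eq_square algebra_simps)
  also have "\<dots> < 0"
    using a b mult_neg_pos[of t a] by (smt (verit) divide_neg_pos t_def zero_le_power2)
  finally show False by simp
qed

lemma invertible_mat_if_trivial_kernel:
  fixes A :: "real mat"
  assumes A: "A \<in> carrier_mat n n" and "\<And>x. x \<in> carrier_vec n \<Longrightarrow> A *\<^sub>v x = 0\<^sub>v n \<Longrightarrow> x = 0\<^sub>v n"
  shows "invertible_mat A"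
proof -
  have "det A \<noteq> 0" using det_0_iff_vec_prod_zero_field[OF A] assms(2) by blast
  from det_non_zero_imp_unit[OF A this, of "()"] obtain B
    where "B \<in> carrier_mat n n" "B * A = 1\<^sub>m n" "A * B = 1\<^sub>m n"
    unfolding Units_def ring_mat_def by auto
  then show ?thesis using A unfolding invertible_mat_def inverts_mat_def by auto
qed

section \<open>Orthogonal changes of coordinates\<close>

lemma dHDAE_congruence:
  assumes H: "dHDAE n E J R" and Z: "Z \<in> carrier_mat n n"
  shows "dHDAE n (transpose_mat Z * E * Z) (transpose_mat Z * J * Z) (transpose_mat Z * R * Z)"
proof -
  have tr: "transpose_mat (transpose_mat Z * A * Z) = transpose_mat Z * transpose_mat A * Z"
    if "A \<in> carrier_mat n n" for A :: "real mat"
    using that Z by (simp add: transpose_mult[where n=n and nr=n and nc=n] assoc_mult_mat[of _ n n _ n _ n])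
  have psd: "psd_mat (transpose_mat Z * A * Z)" if "A \<in> carrier_mat n n" "psd_mat A" for A :: "real mat"
    unfolding psd_mat_def
  proof (intro conjI ballI)
    show "square_mat (transpose_mat Z * A * Z)" using Z by simp
    show "transpose_mat Z * A * Z = transpose_mat (transpose_mat Z * A * Z)"
      using tr[OF that(1)] that(2) by (simp add: psd_mat_def)
    fix x :: "real vec" assume "x \<in> carrier_vec (dim_row (transpose_mat Z * A * Z))"
    then have x: "x \<in> carrier_vec n" using Z by simp
    have "(transpose_mat Z * A * Z) *\<^sub>v x = transpose_mat Z *\<^sub>v (A *\<^sub>v (Z *\<^sub>v x))"
      using Z that(1) x by (simp add: assoc_mult_mat_vec[of _ n n _ n])
    then have "x \<bullet> ((transpose_mat Z * A * Z) *\<^sub>v x) = (Z *\<^sub>v x) \<bullet> (A *\<^sub>v (Z *\<^sub>v x))"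
      using scalar_prod_mult_mat_vec[of "transpose_mat Z" n n x "A *\<^sub>v (Z *\<^sub>v x)"] Z that(1) x by simp
    then show "0 \<le> x \<bullet> ((transpose_mat Z * A * Z) *\<^sub>v x)"
      using that Z x by (auto simp: psd_mat_def)
  qed
  have "transpose_mat J = - J"
    using H by (metis dHDAE_def transpose_transpose transpose_uminus)
  moreover have J: "J \<in> carrier_mat n n" using H by (simp add: dHDAE_def)
  ultimately have "transpose_mat (transpose_mat Z * J * Z) = - (transpose_mat Z * J * Z)"
    unfolding tr[OF J] using Z by simp
  then have "transpose_mat Z * J * Z = - transpose_mat (transpose_mat Z * J * Z)"
    by simp
  then show ?thesis using H Z psd by (auto simp: dHDAE_def)
qed

lemma real_orthogonal_mat_transpose:
  "real_orthogonal_mat n Z \<Longrightarrow> real_orthogonal_mat n (transpose_mat Z)"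
  by (simp add: real_orthogonal_mat_def)

lemma dHDAE_solution_transform:
  assumes Z: "real_orthogonal_mat n Z"
    and E: "E \<in> carrier_mat n n" and J: "J \<in> carrier_mat n n" and R: "R \<in> carrier_mat n n"
    and sol: "dHDAE_solution n E J R T z"
  shows "dHDAE_solution n (transpose_mat Z * E * Z) (transpose_mat Z * J * Z)
           (transpose_mat Z * R * Z) T (\<lambda>t. transpose_mat Z *\<^sub>v z t)"
  unfolding dHDAE_solution_def
proof (intro ballI conjI)
  let ?Zt = "transpose_mat Z"
  have Zc: "Z \<in> carrier_mat n n" and ZZt: "Z * ?Zt = 1\<^sub>m n"
    using Z by (auto simp: real_orthogonal_mat_def)
  have zc: "z s \<in> carrier_vec n" if "s \<in> T" for s using sol that by (auto simp: dHDAE_solution_def)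
  have cong: "(?Zt * A * Z) *\<^sub>v (?Zt *\<^sub>v x) = ?Zt *\<^sub>v (A *\<^sub>v x)"
    if "A \<in> carrier_mat n n" "x \<in> carrier_vec n" for A :: "real mat" and x
  proof -
    have "Z *\<^sub>v (?Zt *\<^sub>v x) = (Z * ?Zt) *\<^sub>v x"
      by (rule assoc_mult_mat_vec[symmetric]) (use Zc that in auto)
    then have "Z *\<^sub>v (?Zt *\<^sub>v x) = x" using ZZt that by simp
    moreover have "(?Zt * A * Z) *\<^sub>v (?Zt *\<^sub>v x) = ?Zt *\<^sub>v (A *\<^sub>v (Z *\<^sub>v (?Zt *\<^sub>v x)))"
      using Zc that by (simp add: assoc_mult_mat_vec[of _ n n _ n])
    ultimately show ?thesis by simp
  qed
  fix t assume t: "t \<in> T"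
  show "?Zt *\<^sub>v z t \<in> carrier_vec n" using Zc zc[OF t] by simp
  from sol t obtain dz where dz: "dz \<in> carrier_vec n"
    and der: "\<And>i. i < n \<Longrightarrow> ((\<lambda>s. z s $ i) has_real_derivative dz $ i) (at t within T)"
    and eq: "E *\<^sub>v dz = (J - R) *\<^sub>v z t"
    unfolding dHDAE_solution_def by blast
  have "((\<lambda>s. (?Zt *\<^sub>v z s) $ i) has_real_derivative (?Zt *\<^sub>v dz) $ i) (at t within T)" if "i < n" for i
  proof -
    have entry: "(?Zt *\<^sub>v x) $ i = (\<Sum>k\<in>{0..<n}. Z $$ (k, i) * x $ k)" if "x \<in> carrier_vec n" for x
      using that Zc \<open>i < n\<close> by (simp add: scalar_prod_def)
    have "((\<lambda>s. \<Sum>k\<in>{0..<n}. Z $$ (k, i) * z s $ k) has_real_derivative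
        (\<Sum>k\<in>{0..<n}. Z $$ (k, i) * dz $ k)) (at t within T)"
      by (intro DERIV_sum DERIV_cmult der) simp
    then show ?thesis
      unfolding entry[OF dz, symmetric] has_field_derivative_def
      by (rule has_derivative_transform[OF t, rotated]) (use entry zc in auto)
  qed
  moreover have "(?Zt * E * Z) *\<^sub>v (?Zt *\<^sub>v dz) = (?Zt * J * Z - ?Zt * R * Z) *\<^sub>v (?Zt *\<^sub>v z t)"
  proof -
    have "(?Zt * J * Z - ?Zt * R * Z) *\<^sub>v (?Zt *\<^sub>v z t)
        = ?Zt *\<^sub>v (J *\<^sub>v z t) - ?Zt *\<^sub>v (R *\<^sub>v z t)"
      using minus_mult_distrib_mat_vec[of "?Zt * J * Z" n n "?Zt * R * Z" "?Zt *\<^sub>v z t"]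
        Zc J R zc[OF t] cong by simp
    also have "\<dots> = ?Zt *\<^sub>v ((J - R) *\<^sub>v z t)"
      using mult_minus_distrib_mat_vec[of ?Zt n n "J *\<^sub>v z t" "R *\<^sub>v z t"]
        minus_mult_distrib_mat_vec[OF J R zc[OF t]] Zc J R zc[OF t] by simp
    finally show ?thesis using cong[OF E dz] eq by simp
  qed
  ultimately show "\<exists>dz\<in>carrier_vec n.
      (\<forall>i<n. ((\<lambda>s. (?Zt *\<^sub>v z s) $ i) has_real_derivative dz $ i) (at t within T)) \<and>
      (?Zt * E * Z) *\<^sub>v dz = (?Zt * J * Z - ?Zt * R * Z) *\<^sub>v (?Zt *\<^sub>v z t)"
    using Zc dz by (intro bexI[of _ "?Zt *\<^sub>v dz"]) auto
qed

text \<open>A solution is only constrained on the time domain, so derivatives within the domain are what has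
  to be transferred.\<close>

lemma dHDAE_solution_cong:
  assumes "\<And>t. t \<in> T \<Longrightarrow> z t = y t" and "dHDAE_solution n E J R T z"
  shows "dHDAE_solution n E J R T y"
proof -
  have "((\<lambda>s. y s $ i) has_real_derivative d) (at t within T)"
    if "t \<in> T" "((\<lambda>s. z s $ i) has_real_derivative d) (at t within T)" for t i d
    using that(2) unfolding has_field_derivative_def
    by (rule has_derivative_transform[OF that(1), rotated]) (use assms(1) in simp)
  then show ?thesis using assms unfolding dHDAE_solution_def by metis
qed

lemma dHDAE_solution_transform_iff:
  assumes Z: "real_orthogonal_mat n Z"
    and A: "E \<in> carrier_mat n n" "J \<in> carrier_mat n n" "R \<in> carrier_mat n n"
    and z: "\<forall>t\<in>T. z t \<in> carrier_vec n"
  shows "dHDAE_solution n E J R T z \<longleftrightarrow>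
    dHDAE_solution n (transpose_mat Z * E * Z) (transpose_mat Z * J * Z)
      (transpose_mat Z * R * Z) T (\<lambda>t. transpose_mat Z *\<^sub>v z t)"
    (is "_ \<longleftrightarrow> dHDAE_solution n ?E ?J ?R T ?z")
proof
  assume sol: "dHDAE_solution n ?E ?J ?R T ?z"
  have Zc: "Z \<in> carrier_mat n n" and ZZt: "Z * transpose_mat Z = 1\<^sub>m n"
    using Z by (auto simp: real_orthogonal_mat_def)
  have inv: "Z * (transpose_mat Z * A * Z) * transpose_mat Z = A" if "A \<in> carrier_mat n n" for A :: "real mat"
  proof -
    have "Z * (transpose_mat Z * A * Z) * transpose_mat Z
        = (Z * transpose_mat Z) * A * (Z * transpose_mat Z)"
      using Zc that by (simp add: assoc_mult_mat[of _ n n _ n _ n])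
    then show ?thesis using ZZt that by simp
  qed
  have "Z *\<^sub>v (transpose_mat Z *\<^sub>v z t) = z t" if "t \<in> T" for t
  proof -
    have "Z *\<^sub>v (transpose_mat Z *\<^sub>v z t) = (Z * transpose_mat Z) *\<^sub>v z t"
      by (rule assoc_mult_mat_vec[symmetric]) (use Zc z that in auto)
    then show ?thesis using ZZt z that by simp
  qed
  moreover have "dHDAE_solution n E J R T (\<lambda>t. Z *\<^sub>v (transpose_mat Z *\<^sub>v z t))"
    using dHDAE_solution_transform[OF real_orthogonal_mat_transpose[OF Z] _ _ _ sol] Zc A inv
    by simp
  ultimately show "dHDAE_solution n E J R T z" by (rule dHDAE_solution_cong)
qed (rule dHDAE_solution_transform[OF Z A])

section \<open>Blocks\<close>

text \<open>The matrix with entries \<open>u \<bullet> A v\<close>, with \<open>u\<close> running over \<open>us\<close> and \<open>v\<close> over \<open>vs\<close>. For orthonormal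
  lists it represents \<open>A\<close> restricted to the span of \<open>vs\<close> and projected to the span of \<open>us\<close>.\<close>

definition compression :: "nat \<Rightarrow> real vec list \<Rightarrow> real mat \<Rightarrow> real vec list \<Rightarrow> real mat" where
  "compression n us A vs = transpose_mat (mat_of_cols n us) * A * mat_of_cols n vs"

lemma compression_carrier [simp]:
  "compression n us A vs \<in> carrier_mat (length us) (length vs)"
  "dim_row (compression n us A vs) = length us"
  "dim_col (compression n us A vs) = length vs"
  unfolding compression_def by (auto intro!: carrier_matI)

context
  fixes n :: nat and A :: "real mat" and us vs :: "real vec list"
  assumes A: "A \<in> carrier_mat n n"
    and us: "set us \<subseteq> carrier_vec n" and vs: "set vs \<subseteq> carrier_vec n"
begin

lemma compression_mult_vec:
  assumes "x \<in> carrier_vec (length vs)"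
  shows "compression n us A vs *\<^sub>v x = vec (length us) (\<lambda>i. us ! i \<bullet> (A *\<^sub>v (mat_of_cols n vs *\<^sub>v x)))"
proof -
  have "compression n us A vs *\<^sub>v x
      = (transpose_mat (mat_of_cols n us) * A) *\<^sub>v (mat_of_cols n vs *\<^sub>v x)"
    unfolding compression_def by (rule assoc_mult_mat_vec) (use A assms in auto)
  also have "\<dots> = transpose_mat (mat_of_cols n us) *\<^sub>v (A *\<^sub>v (mat_of_cols n vs *\<^sub>v x))"
    by (rule assoc_mult_mat_vec[where n\<^sub>2=n])
      (use A assms in \<open>auto intro!: mult_mat_vec_carrier[of _ n "length vs"]\<close>)
  finally show ?thesis unfolding transpose_mat_of_cols_mult_vec[OF us] .
qed

lemma compression_index:
  assumes "i < length us" "j < length vs"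
  shows "compression n us A vs $$ (i, j) = us ! i \<bullet> (A *\<^sub>v vs ! j)"
proof -
  have v: "vs ! j \<in> carrier_vec n" using vs assms by auto
  have "col (compression n us A vs) j = compression n us A vs *\<^sub>v unit_vec (length vs) j"
    using assms by (intro eq_vecI) auto
  also have "\<dots> = vec (length us) (\<lambda>i. us ! i \<bullet> (A *\<^sub>v (mat_of_cols n vs *\<^sub>v unit_vec (length vs) j)))"
    by (rule compression_mult_vec) simp
  also have "mat_of_cols n vs *\<^sub>v unit_vec (length vs) j = vs ! j"
    using assms v by (intro eq_vecI) (auto simp: mat_of_cols_index)
  finally have "col (compression n us A vs) j $ i = us ! i \<bullet> (A *\<^sub>v vs ! j)"
    using assms by simp
  then show ?thesis using assms by simp
qed

lemma compression_eq_0: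
  assumes "\<And>u v. u \<in> set us \<Longrightarrow> v \<in> set vs \<Longrightarrow> u \<bullet> (A *\<^sub>v v) = 0"
  shows "compression n us A vs = 0\<^sub>m (length us) (length vs)"
  using assms by (intro eq_matI) (auto simp: compression_index)

lemma compression_mult_vec_eq_0:
  assumes "x \<in> carrier_vec (length vs)" "compression n us A vs *\<^sub>v x = 0\<^sub>v (length us)" "u \<in> set us"
  shows "u \<bullet> (A *\<^sub>v (mat_of_cols n vs *\<^sub>v x)) = 0"
proof -
  from assms(3) obtain i where "i < length us" "u = us ! i" by (metis in_set_conv_nth)
  then show ?thesis
    using assms(2) unfolding compression_mult_vec[OF assms(1)] by (metis index_vec index_zero_vec(1))
qed

lemma compression_quadratic_form:
  assumes x: "x \<in> carrier_vec (length us)" "y \<in> carrier_vec (length vs)"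
  shows "x \<bullet> (compression n us A vs *\<^sub>v y) = (mat_of_cols n us *\<^sub>v x) \<bullet> (A *\<^sub>v (mat_of_cols n vs *\<^sub>v y))"
proof -
  let ?w = "A *\<^sub>v (mat_of_cols n vs *\<^sub>v y)"
  have "mat_of_cols n vs *\<^sub>v y \<in> carrier_vec n" by (rule mult_mat_vec_carrier[OF _ x(2)]) simp
  then have w: "?w \<in> carrier_vec n" using A by simp
  have "compression n us A vs *\<^sub>v y = transpose_mat (mat_of_cols n us) *\<^sub>v ?w"
    unfolding compression_mult_vec[OF x(2)] transpose_mat_of_cols_mult_vec[OF us] ..
  then show ?thesis
    using scalar_prod_mult_mat_vec[of "transpose_mat (mat_of_cols n us)" "length us" n x ?w] x w by simp
qed

end

lemma compression_minus:
  assumes "A \<in> carrier_mat n n" "B \<in> carrier_mat n n"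
  shows "compression n us (A - B) vs = compression n us A vs - compression n us B vs"
proof -
  let ?Ut = "transpose_mat (mat_of_cols n us)" and ?V = "mat_of_cols n vs"
  have "?Ut * (A - B) * ?V = (?Ut * A - ?Ut * B) * ?V"
    using mult_minus_distrib_mat[of ?Ut "length us" n A n B] assms by simp
  also have "\<dots> = ?Ut * A * ?V - ?Ut * B * ?V"
    by (rule minus_mult_distrib_mat) (use assms in auto)
  finally show ?thesis unfolding compression_def .
qed

lemma transpose_compression:
  assumes "A \<in> carrier_mat n n"
  shows "transpose_mat (compression n us A vs) = compression n vs (transpose_mat A) us"
proof -
  let ?Ut = "transpose_mat (mat_of_cols n us)" and ?V = "mat_of_cols n vs"
  have "transpose_mat (?Ut * A * ?V) = transpose_mat ?V * transpose_mat (?Ut * A)"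
    by (rule transpose_mult[of _ "length us" n _ "length vs"]) (use assms in auto)
  also have "transpose_mat (?Ut * A) = transpose_mat A * mat_of_cols n us"
    using transpose_mult[of ?Ut "length us" n A n] assms by simp
  also have "transpose_mat ?V * (transpose_mat A * mat_of_cols n us)
      = transpose_mat ?V * transpose_mat A * mat_of_cols n us"
    by (rule assoc_mult_mat[symmetric]) (use assms in auto)
  finally show ?thesis unfolding compression_def .
qed

lemma compression_skew:
  assumes J: "J \<in> carrier_mat n n" "J = - transpose_mat J"
    and us: "set us \<subseteq> carrier_vec n" and vs: "set vs \<subseteq> carrier_vec n"
  shows "compression n us J vs = - transpose_mat (compression n vs J us)"
proof (rule eq_matI)
  fix i j assume "i < dim_row (- transpose_mat (compression n vs J us))"
    "j < dim_col (- transpose_mat (compression n vs J us))"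
  then have ij: "i < length us" "j < length vs" by auto
  then have "us ! i \<in> carrier_vec n" "vs ! j \<in> carrier_vec n" using us vs by auto
  from skew_scalar_prod[OF J this] ij
  show "compression n us J vs $$ (i, j) = (- transpose_mat (compression n vs J us)) $$ (i, j)"
    by (simp add: compression_index[OF J(1) us vs] compression_index[OF J(1) vs us])
qed auto

text \<open>The \<open>m\<close> by \<open>k\<close> submatrix of \<open>A\<close> with upper left corner at row \<open>r\<close> and column \<open>c\<close>, counted from
  \<open>0\<close>. Adjacent slices join to a larger slice, which reassembles a matrix from its blocks.\<close>

definition slice :: "'a mat \<Rightarrow> nat \<Rightarrow> nat \<Rightarrow> nat \<Rightarrow> nat \<Rightarrow> 'a mat" where
  "slice A r m c k = mat m k (\<lambda>(a, b). A $$ (r + a, c + b))"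

lemma dim_slice [simp]: "dim_row (slice A r m c k) = m" "dim_col (slice A r m c k) = k"
  by (simp_all add: slice_def)

lemma slice_all: "A \<in> carrier_mat m k \<Longrightarrow> slice A 0 m 0 k = A"
  by (intro eq_matI) (auto simp: slice_def)

lemma blk_eq_slice:
  "blk ns A i j = slice A (sum_list (take (i - 1) ns)) (ns ! (i - 1))
     (sum_list (take (j - 1) ns)) (ns ! (j - 1))"
  by (simp add: blk_def slice_def)

lemma slice_beside:
  assumes "c' = c + k"
  shows "four_block_mat (slice A r m c k) (slice A r m c' l) (0\<^sub>m 0 k) (0\<^sub>m 0 l) = slice A r m c (k + l)"
  by (intro eq_matI) (auto simp: assms slice_def add.assoc)

lemma slice_above:
  assumes "r' = r + m"
  shows "slice A r m c k @\<^sub>r slice A r' l c k = slice A r (m + l) c k"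
  unfolding append_rows_def by (intro eq_matI) (auto simp: assms slice_def add.assoc)

lemma block_mat_blk_5_5:
  assumes "A \<in> carrier_mat n n" "n1 + n2 + n3 + n4 + n5 = n"
  defines "ns \<equiv> [n1, n2, n3, n4, n5]"
  shows "block_mat
    [[blk ns A 1 1, blk ns A 1 2, blk ns A 1 3, blk ns A 1 4, blk ns A 1 5],
     [blk ns A 2 1, blk ns A 2 2, blk ns A 2 3, blk ns A 2 4, blk ns A 2 5],
     [blk ns A 3 1, blk ns A 3 2, blk ns A 3 3, blk ns A 3 4, blk ns A 3 5],
     [blk ns A 4 1, blk ns A 4 2, blk ns A 4 3, blk ns A 4 4, blk ns A 4 5],
     [blk ns A 5 1, blk ns A 5 2, blk ns A 5 3, blk ns A 5 4, blk ns A 5 5]] = A"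
proof -
  have "A = slice A 0 (n1 + (n2 + (n3 + (n4 + n5)))) 0 (n1 + (n2 + (n3 + (n4 + n5))))"
    using slice_all[OF assms(1)] assms(2) by (simp add: add.assoc)
  then show ?thesis
    by (simp add: ns_def block_mat_def blk_eq_slice slice_beside slice_above Let_def)
qed

lemma block_mat_blk_2_2:
  "block_mat [[blk (n1 # n2 # ns) A 1 1, blk (n1 # n2 # ns) A 1 2],
     [blk (n1 # n2 # ns) A 2 1, blk (n1 # n2 # ns) A 2 2]] = slice A 0 (n1 + n2) 0 (n1 + n2)"
  by (simp add: block_mat_def blk_eq_slice slice_beside slice_above Let_def)

lemma slice_compression:
  assumes A: "A \<in> carrier_mat n n" and c: "set cs \<subseteq> carrier_vec n"
    and us: "cs = ps @ us @ qs" and vs: "cs = ps' @ vs @ qs'"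
  shows "slice (compression n cs A cs) (length ps) (length us) (length ps') (length vs)
    = compression n us A vs" (is "?S = _")
proof (rule eq_matI)
  fix i j assume "i < dim_row (compression n us A vs)" "j < dim_col (compression n us A vs)"
  then have ij: "i < length us" "j < length vs" by auto
  have cs: "cs ! (length ps + i) = us ! i" "length ps + i < length cs"
    using ij by (simp_all add: us nth_append)
  have cs': "cs ! (length ps' + j) = vs ! j" "length ps' + j < length cs"
    using ij by (simp_all add: vs nth_append)
  have c': "set us \<subseteq> carrier_vec n" using c unfolding us by simp
  have c'': "set vs \<subseteq> carrier_vec n" using c unfolding vs by simp
  have "?S $$ (i, j) = compression n cs A cs $$ (length ps + i, length ps' + j)"
    using ij by (simp add: slice_def)
  also have "\<dots> = us ! i \<bullet> (A *\<^sub>v vs ! j)"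
    using compression_index[OF A c c cs(2) cs'(2)] cs cs' by simp
  also have "\<dots> = compression n us A vs $$ (i, j)"
    using compression_index[OF A c' c'' ij] by simp
  finally show "?S $$ (i, j) = compression n us A vs $$ (i, j)" .
qed auto

text \<open>Changing coordinates to a basis that is split into groups \<open>css\<close> makes each block of the new matrix
  the compression to the corresponding pair of groups.\<close>

lemma blk_compression:
  assumes A: "A \<in> carrier_mat n n" and c: "set (concat css) \<subseteq> carrier_vec n"
    and i: "1 \<le> i" "i \<le> length css" and j: "1 \<le> j" "j \<le> length css"
  shows "blk (map length css) (compression n (concat css) A (concat css)) i j
    = compression n (css ! (i - 1)) A (css ! (j - 1))"
proof -
  have split: "concat css = concat (take (k - 1) css) @ css ! (k - 1) @ concat (drop k css)"
    if "1 \<le> k" "k \<le> length css" for k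
    using id_take_nth_drop[of "k - 1" css] that
    by (metis One_nat_def Suc_diff_1 concat.simps(2) concat_append less_eq_Suc_le)
  have len: "sum_list (take k (map length css)) = length (concat (take k css))" for k
    by (simp add: length_concat take_map)
  have "i - 1 < length css" "j - 1 < length css" using i j by auto
  then show ?thesis
    using slice_compression[OF A c split[OF i] split[OF j]]
    unfolding blk_eq_slice len by simp
qed

section \<open>The adapted basis\<close>

lemma orthonormal_basis_set_cong:
  assumes "orthonormal_basis n S us" "distinct vs" "set vs = set us"
  shows "orthonormal_basis n S vs"
  using assms by (simp add: orthonormal_basis_def orthonormal_def)

lemma orthonormal_basis_rotate:
  assumes "orthonormal_basis n S (us @ vs)"
  shows "orthonormal_basis n S (vs @ us)"
proof -
  have "distinct (us @ vs)" using assms by (simp add: orthonormal_basis_def orthonormal_def)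
  then show ?thesis by (intro orthonormal_basis_set_cong[OF assms]) auto
qed

lemma orthonormal_basis_superspace:
  assumes "orthonormal_basis n S us" "S \<subseteq> T" "vec_subspace n T"
  obtains vs where "orthonormal_basis n T (us @ vs)"
proof -
  have "orthonormal n us" "set us \<subseteq> T" using assms(1,2) by (auto simp: orthonormal_basis_def)
  from orthonormal_basis_extend[OF assms(3) this] that show thesis by blast
qed

lemma orthonormal_basis_append_ortho_compl:
  assumes S: "vec_subspace n S" and us: "orthonormal_basis n S us"
    and vs: "orthonormal_basis n (ortho_compl n S) vs"
  shows "orthonormal_basis n (carrier_vec n) (vs @ us)"
proof -
  have "v \<bullet> u = 0" if "u \<in> set us" "v \<in> set vs" for u v
    using us vs that by (auto simp: orthonormal_basis_def ortho_compl_iff subset_iff)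
  then have "orthonormal n (vs @ us)"
    using us vs by (auto simp: orthonormal_append orthonormal_basis_def)
  moreover have "x = 0\<^sub>v n" if "x \<in> carrier_vec n" "\<forall>c\<in>set (vs @ us). c \<bullet> x = 0" for x
  proof -
    have "x \<in> ortho_compl n S" using orthonormal_basis_ortho[OF S us] that by auto
    then show ?thesis using vs that(2) by (auto simp: orthonormal_basis_def)
  qed
  ultimately show ?thesis by (auto simp: orthonormal_basis_def orthonormal_def)
qed

lemma orthonormal_basis_carrier_orthogonal_mat:
  assumes "orthonormal_basis n (carrier_vec n) cs"
  shows "length cs = n" "real_orthogonal_mat n (mat_of_cols n cs)"
proof -
  let ?M = "mat_of_cols n cs"
  have on: "orthonormal n cs" and c: "set cs \<subseteq> carrier_vec n"
    using assms by (auto simp: orthonormal_basis_def)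
  show len: "length cs = n"
  proof (rule antisym[OF orthonormal_length_le[OF on] leI], rule notI)
    assume "length cs < n"
    then obtain v where v: "v \<in> carrier_vec n" "v \<noteq> 0\<^sub>v n" "transpose_mat ?M *\<^sub>v v = 0\<^sub>v (length cs)"
      using wide_mat_kernel_nontrivial[of "transpose_mat ?M" "length cs" n] by auto
    from v(3) have "\<forall>i<length cs. cs ! i \<bullet> v = 0"
      unfolding transpose_mat_of_cols_mult_vec[OF c] by (metis index_vec index_zero_vec(1))
    then show False using assms v by (auto simp: orthonormal_basis_def all_set_conv_all_nth)
  qed
  have M: "?M \<in> carrier_mat n n" using len mat_of_cols_carrier(1)[of n cs] by simp
  have MtM: "transpose_mat ?M * ?M = 1\<^sub>m n" using orthonormal_transpose_mult[OF on] len by simp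
  show "real_orthogonal_mat n ?M"
    using M MtM mat_mult_left_right_inverse[OF _ M MtM] by (simp add: real_orthogonal_mat_def)
qed

lemma orthonormal_mat_of_cols_mult_eq_0:
  assumes "orthonormal n cs" "x \<in> carrier_vec (length cs)" "mat_of_cols n cs *\<^sub>v x = 0\<^sub>v n"
  shows "x = 0\<^sub>v (length cs)"
proof -
  let ?M = "mat_of_cols n cs"
  have "x = (transpose_mat ?M * ?M) *\<^sub>v x" using orthonormal_transpose_mult assms by simp
  also have "\<dots> = transpose_mat ?M *\<^sub>v (?M *\<^sub>v x)"
    by (rule assoc_mult_mat_vec) (use assms in auto)
  also have "\<dots> = 0\<^sub>v (length cs)" unfolding assms(3) by auto
  finally show ?thesis .
qed

lemma mat_of_cols_mult_ortho:
  assumes "orthonormal n (us @ vs)" "x \<in> carrier_vec (length us)" "v \<in> set vs"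
  shows "(mat_of_cols n us *\<^sub>v x) \<bullet> v = 0"
proof -
  have "vec_subspace n (ortho_compl n {v})"
    using assms by (intro vec_subspace_ortho_compl) (auto simp: orthonormal_def)
  moreover have "set us \<subseteq> ortho_compl n {v}"
    using assms by (auto simp: ortho_compl_iff orthonormal_append orthonormal_def)
  ultimately have "mat_of_cols n us *\<^sub>v x \<in> ortho_compl n {v}"
    using assms(2) by (rule vec_subspace_mat_of_cols_mult)
  then show ?thesis by (simp add: ortho_compl_iff)
qed

text \<open>The orthonormal basis behind the block form, in its five groups \<open>c1\<close>, \<open>c2\<close>, \<open>c3\<close>, \<open>c4\<close>, \<open>c5\<close> of columns of \<open>Z\<close>.\<close>

lemma dHDAE_adapted_basis:
  assumes H: "dHDAE n E J R"
  obtains c1 c2 c3 c4 c5 where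
    "orthonormal_basis n (carrier_vec n) (c1 @ c2 @ c3 @ c4 @ c5)" "length c4 = length c1"
    "\<And>v. v \<in> set (c3 @ c4 @ c5) \<Longrightarrow> E *\<^sub>v v = 0\<^sub>v n"
    "\<And>v. v \<in> set (c4 @ c5) \<Longrightarrow> R *\<^sub>v v = 0\<^sub>v n"
    "\<And>u v. u \<in> set (c2 @ c3 @ c4 @ c5) \<Longrightarrow> v \<in> set c4 \<Longrightarrow> u \<bullet> (J *\<^sub>v v) = 0"
    "\<And>v. v \<in> set c5 \<Longrightarrow> J *\<^sub>v v = 0\<^sub>v n"
    "pd_mat (compression n (c1 @ c2) E (c1 @ c2))"
    "invertible_mat (compression n c3 (J - R) c3)"
    "invertible_mat (compression n c4 J c1)"
proof -
  have E: "E \<in> carrier_mat n n" "psd_mat E" and J: "J \<in> carrier_mat n n" "J = - transpose_mat J"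
    and R: "R \<in> carrier_mat n n" "psd_mat R"
    using H by (auto simp: dHDAE_def)
  define N where "N = mat_kernel E"
  define W where "W = ortho_compl n N"
  define K where "K = N \<inter> mat_kernel R \<inter> {x \<in> carrier_vec n. J *\<^sub>v x \<in> W}"
  define L where "L = K \<inter> mat_kernel J"
  define JK where "JK = (*\<^sub>v) J ` K"
  have N_iff: "x \<in> N \<longleftrightarrow> x \<in> carrier_vec n \<and> E *\<^sub>v x = 0\<^sub>v n" for x
    by (auto simp: N_def mat_kernel[OF E(1)])
  have W_iff: "x \<in> W \<longleftrightarrow> x \<in> carrier_vec n \<and> (\<forall>y\<in>N. x \<bullet> y = 0)" for x
    by (simp add: W_def ortho_compl_iff)
  have K_iff: "x \<in> K \<longleftrightarrow> x \<in> N \<and> R *\<^sub>v x = 0\<^sub>v n \<and> J *\<^sub>v x \<in> W" for x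
    by (auto simp: K_def N_iff mat_kernel[OF R(1)])
  have L_iff: "x \<in> L \<longleftrightarrow> x \<in> K \<and> J *\<^sub>v x = 0\<^sub>v n" for x
    by (auto simp: L_def K_iff N_iff mat_kernel[OF J(1)])
  have Nc: "N \<subseteq> carrier_vec n" by (auto simp: N_iff)
  have subN: "vec_subspace n N" unfolding N_def by (rule vec_subspace_mat_kernel[OF E(1)])
  have subW: "vec_subspace n W" unfolding W_def by (rule vec_subspace_ortho_compl[OF Nc])
  have subK: "vec_subspace n K" unfolding K_def
    by (intro vec_subspace_inter subN vec_subspace_mat_kernel[OF R(1)] vec_subspace_preimage[OF J(1) subW])
  have subL: "vec_subspace n L" unfolding L_def
    by (intro vec_subspace_inter subK vec_subspace_mat_kernel[OF J(1)])
  have subJK: "vec_subspace n JK" unfolding JK_def by (rule vec_subspace_image[OF J(1) subK])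
  have "JK \<subseteq> W" "K \<subseteq> N" "L \<subseteq> K" by (auto simp: JK_def K_iff L_iff)

  obtain c5 where c5: "orthonormal_basis n L c5"
    using orthonormal_basis_extend[OF subL, of "[]"] by (auto simp: orthonormal_def)
  obtain c4 where "orthonormal_basis n K (c5 @ c4)"
    using orthonormal_basis_superspace[OF c5 \<open>L \<subseteq> K\<close> subK] by blast
  then have c45: "orthonormal_basis n K (c4 @ c5)" by (rule orthonormal_basis_rotate)
  obtain c3 where "orthonormal_basis n N ((c4 @ c5) @ c3)"
    using orthonormal_basis_superspace[OF c45 \<open>K \<subseteq> N\<close> subN] by blast
  then have c345: "orthonormal_basis n N (c3 @ c4 @ c5)" by (rule orthonormal_basis_rotate)
  obtain c1 where c1: "orthonormal_basis n JK c1"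
    using orthonormal_basis_extend[OF subJK, of "[]"] by (auto simp: orthonormal_def)
  obtain c2 where c12: "orthonormal_basis n W (c1 @ c2)"
    using orthonormal_basis_superspace[OF c1 \<open>JK \<subseteq> W\<close> subW] by blast
  have basis: "orthonormal_basis n (carrier_vec n) (c1 @ c2 @ c3 @ c4 @ c5)"
    using orthonormal_basis_append_ortho_compl[OF subN c345, of "c1 @ c2"] c12 by (simp add: W_def)
  then have on: "orthonormal n (c1 @ c2 @ c3 @ c4 @ c5)" by (simp add: orthonormal_basis_def)
  then have c: "set c1 \<subseteq> carrier_vec n" "set c2 \<subseteq> carrier_vec n" "set c3 \<subseteq> carrier_vec n"
    "set c4 \<subseteq> carrier_vec n" "set c5 \<subseteq> carrier_vec n"
    by (auto simp: orthonormal_def)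
  have mem: "set c1 \<subseteq> JK" "set (c1 @ c2) \<subseteq> W" "set c3 \<subseteq> N" "set c4 \<subseteq> K" "set c5 \<subseteq> L"
    using c1 c12 c345 c45 c5 by (auto simp: orthonormal_basis_def)
  have skew: "x \<bullet> (J *\<^sub>v y) = - (y \<bullet> (J *\<^sub>v x))"
    if "x \<in> carrier_vec n" "y \<in> carrier_vec n" for x y
    using skew_scalar_prod[OF J that] .
  have comm: "x \<bullet> y = y \<bullet> x" if "x \<in> carrier_vec n" "y \<in> carrier_vec n" for x y :: "real vec"
    using comm_scalar_prod[OF that] .

  have pd: "pd_mat (compression n (c1 @ c2) E (c1 @ c2))" (is "pd_mat ?E")
    unfolding pd_mat_def
  proof (intro conjI ballI impI)
    show "square_mat ?E" by simp
    have "transpose_mat E = E" using E(2) by (simp add: psd_mat_def)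
    then show "?E = transpose_mat ?E"
      using transpose_compression[OF E(1), of "c1 @ c2" "c1 @ c2"] by simp
    fix x :: "real vec" assume "x \<in> carrier_vec (dim_row ?E)" "x \<noteq> 0\<^sub>v (dim_row ?E)"
    then have x: "x \<in> carrier_vec (length (c1 @ c2))" "x \<noteq> 0\<^sub>v (length (c1 @ c2))" by simp_all
    define y where "y = mat_of_cols n (c1 @ c2) *\<^sub>v x"
    have yW: "y \<in> W" unfolding y_def by (rule vec_subspace_mat_of_cols_mult[OF subW mem(2) x(1)])
    then have y: "y \<in> carrier_vec n" by (simp add: W_iff)
    have "y \<noteq> 0\<^sub>v n"
      using orthonormal_mat_of_cols_mult_eq_0[OF _ x(1)] x(2) c12
      by (auto simp: y_def orthonormal_basis_def)
    moreover have "y \<bullet> y = 0" if "y \<bullet> (E *\<^sub>v y) = 0"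
      using psd_mat_quadratic_form_eq_0[OF E(2,1) y that] yW y by (auto simp: W_iff N_iff)
    ultimately have "y \<bullet> (E *\<^sub>v y) \<noteq> 0" using scalar_prod_self_pos[OF y] by auto
    moreover have "0 \<le> y \<bullet> (E *\<^sub>v y)" using E y by (auto simp: psd_mat_def)
    moreover have "x \<bullet> (?E *\<^sub>v x) = y \<bullet> (E *\<^sub>v y)"
      using compression_quadratic_form[OF E(1), of "c1 @ c2" "c1 @ c2" x x] c x(1) by (simp add: y_def)
    ultimately show "0 < x \<bullet> (?E *\<^sub>v x)" by simp
  qed

  have inv3: "invertible_mat (compression n c3 (J - R) c3)"
  proof (rule invertible_mat_if_trivial_kernel[OF compression_carrier(1)])
    fix x assume x: "x \<in> carrier_vec (length c3)" and x0: "compression n c3 (J - R) c3 *\<^sub>v x = 0\<^sub>v (length c3)"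
    have JR: "J - R \<in> carrier_mat n n" by (rule minus_carrier_mat[OF R(1)])
    define y where "y = mat_of_cols n c3 *\<^sub>v x"
    have yN: "y \<in> N" unfolding y_def by (rule vec_subspace_mat_of_cols_mult[OF subN mem(3) x])
    then have y: "y \<in> carrier_vec n" by (simp add: N_iff)
    have JRy: "u \<bullet> ((J - R) *\<^sub>v y) = u \<bullet> (J *\<^sub>v y) - u \<bullet> (R *\<^sub>v y)" if "u \<in> carrier_vec n" for u
      using minus_mult_distrib_mat_vec[OF J(1) R(1) y] scalar_prod_minus_distrib[OF that, of "J *\<^sub>v y" "R *\<^sub>v y"]
        J(1) R(1) y by simp
    have "y \<bullet> (J *\<^sub>v y) = 0" using skew[OF y y] by simp
    moreover have "y \<bullet> ((J - R) *\<^sub>v y) = 0"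
      using compression_quadratic_form[OF JR c(3,3) x x] x0 x by (simp add: y_def)
    ultimately have "y \<bullet> (R *\<^sub>v y) = 0" using JRy[OF y] by simp
    then have Ry: "R *\<^sub>v y = 0\<^sub>v n" by (rule psd_mat_quadratic_form_eq_0[OF R(2,1) y])
    \<comment> \<open>For \<open>u\<close> in \<open>c3\<close> this is the kernel equation; for \<open>u \<in> K\<close> it is \<open>- (y \<bullet> J u)\<close>, where \<open>J u \<in> W\<close> and \<open>y \<in> N\<close>.\<close>
    have "u \<bullet> (J *\<^sub>v y) = 0" if "u \<in> set (c3 @ c4 @ c5)" for u
    proof (cases "u \<in> set c3")
      case True
      then show ?thesis
        using compression_mult_vec_eq_0[OF JR c(3,3) x x0, of u] JRy[of u] Ry c(3)
        by (auto simp: y_def[symmetric])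
    next
      case False
      then have u: "u \<in> K" using that mem \<open>L \<subseteq> K\<close> by auto
      then have "u \<in> carrier_vec n" "(J *\<^sub>v u) \<bullet> y = 0" using yN by (auto simp: K_iff N_iff W_iff)
      then show ?thesis using skew[of u y] comm[of "J *\<^sub>v u" y] J(1) y by simp
    qed
    then have "J *\<^sub>v y \<in> W"
      unfolding W_def using J(1) y by (intro orthonormal_basis_ortho[OF subN c345]) auto
    then have "y \<in> K" using yN Ry by (simp add: K_iff)
    moreover have "v \<bullet> y = 0" if "v \<in> set (c4 @ c5)" for v
      using mat_of_cols_mult_ortho[of n c3 "c4 @ c5" x v] c345 x that comm[OF y, of v] c
      by (auto simp: y_def orthonormal_basis_def)
    ultimately have "y = 0\<^sub>v n" using c45 by (simp add: orthonormal_basis_def)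
    then show "x = 0\<^sub>v (length c3)"
      using orthonormal_mat_of_cols_mult_eq_0[of n c3 x] on x by (simp add: y_def orthonormal_append)
  qed

  \<comment> \<open>A vector \<open>y = J k\<close> of \<open>J K\<close> with \<open>J y\<close> orthogonal to \<open>K\<close> satisfies \<open>y \<bullet> y = y \<bullet> J k = - (k \<bullet> J y) = 0\<close>.\<close>
  have ker41: "x = 0\<^sub>v (length c1)"
    if x: "x \<in> carrier_vec (length c1)" and x0: "compression n c4 J c1 *\<^sub>v x = 0\<^sub>v (length c4)" for x
  proof -
    define y where "y = mat_of_cols n c1 *\<^sub>v x"
    have "y \<in> JK" unfolding y_def by (rule vec_subspace_mat_of_cols_mult[OF subJK mem(1) x])
    then obtain k where k: "k \<in> K" "y = J *\<^sub>v k" by (auto simp: JK_def)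
    have kc: "k \<in> carrier_vec n" and y: "y \<in> carrier_vec n"
      using k J(1) by (auto simp: K_iff N_iff)
    have "u \<bullet> (J *\<^sub>v y) = 0" if "u \<in> set (c4 @ c5)" for u
    proof (cases "u \<in> set c4")
      case True
      then show ?thesis
        using compression_mult_vec_eq_0[OF J(1) c(4,1) x x0, of u] by (simp add: y_def)
    next
      case False
      then have "u \<in> carrier_vec n" "J *\<^sub>v u = 0\<^sub>v n"
        using that mem(5) c(5) by (auto simp: L_iff)
      then show ?thesis using skew[of u y] y by simp
    qed
    then have "J *\<^sub>v y \<in> ortho_compl n K"
      using J(1) y by (intro orthonormal_basis_ortho[OF subK c45]) auto
    then have "k \<bullet> (J *\<^sub>v y) = 0"
      using k(1) kc J(1) y comm[of k "J *\<^sub>v y"] by (simp add: ortho_compl_iff)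
    then have "y \<bullet> y = 0" using skew[OF kc y] k(2) by simp
    then have "y = 0\<^sub>v n" using scalar_prod_self_pos[OF y] by auto
    then show ?thesis
      using orthonormal_mat_of_cols_mult_eq_0[of n c1 x] on x by (simp add: y_def orthonormal_append)
  qed
  \<comment> \<open>A vector \<open>y\<close> of \<open>K\<close> orthogonal to \<open>L\<close> with \<open>J y\<close> orthogonal to \<open>J K\<close> satisfies \<open>J y = 0\<close>, so \<open>y \<in> L\<close>.\<close>
  have ker14: "x = 0\<^sub>v (length c4)"
    if x: "x \<in> carrier_vec (length c4)" and x0: "compression n c1 J c4 *\<^sub>v x = 0\<^sub>v (length c1)" for x
  proof -
    define y where "y = mat_of_cols n c4 *\<^sub>v x"
    have yK: "y \<in> K" unfolding y_def by (rule vec_subspace_mat_of_cols_mult[OF subK mem(4) x])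
    then have y: "y \<in> carrier_vec n" by (simp add: K_iff N_iff)
    have "J *\<^sub>v y \<in> JK" using yK by (simp add: JK_def)
    moreover have "u \<bullet> (J *\<^sub>v y) = 0" if "u \<in> set c1" for u
      using compression_mult_vec_eq_0[OF J(1) c(1,4) x x0 that] by (simp add: y_def)
    ultimately have "J *\<^sub>v y = 0\<^sub>v n" using c1 by (simp add: orthonormal_basis_def)
    then have "y \<in> L" using yK by (simp add: L_iff)
    moreover have "v \<bullet> y = 0" if "v \<in> set c5" for v
      using mat_of_cols_mult_ortho[of n c4 c5 x v] c45 x that comm[OF y, of v] c
      by (auto simp: y_def orthonormal_basis_def)
    ultimately have "y = 0\<^sub>v n" using c5 by (simp add: orthonormal_basis_def)
    then show ?thesis
      using orthonormal_mat_of_cols_mult_eq_0[of n c4 x] on x by (simp add: y_def orthonormal_append)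
  qed
  have len: "length c4 = length c1"
  proof (rule linorder_cases)
    assume "length c4 < length c1"
    then show ?thesis using wide_mat_kernel_nontrivial[OF compression_carrier(1)] ker41 by metis
  next
    assume "length c1 < length c4"
    then show ?thesis using wide_mat_kernel_nontrivial[OF compression_carrier(1)] ker14 by metis
  qed
  have inv41: "invertible_mat (compression n c4 J c1)"
    using invertible_mat_if_trivial_kernel[of "compression n c4 J c1" "length c1"] ker41
      compression_carrier(1)[of n c4 J c1] unfolding len by blast

  have JK4: "u \<bullet> (J *\<^sub>v v) = 0" if u: "u \<in> set (c2 @ c3 @ c4 @ c5)" and v: "v \<in> set c4" for u v
  proof -
    have vK: "v \<in> K" and Jv: "J *\<^sub>v v \<in> carrier_vec n" using v mem(4) c(4) J(1) by auto
    have uc: "u \<in> carrier_vec n" using u c by auto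
    show ?thesis
    proof (cases "u \<in> set c2")
      case True
      then have "u \<in> ortho_compl n JK"
        using orthonormal_basis_ortho[OF subJK c1 uc] on by (auto simp: orthonormal_append)
      then show ?thesis using vK by (auto simp: ortho_compl_iff JK_def)
    next
      case False
      then have "u \<in> N" using u mem \<open>L \<subseteq> K\<close> \<open>K \<subseteq> N\<close> by auto
      then show ?thesis using vK comm[OF uc Jv] by (auto simp: K_iff W_iff)
    qed
  qed
  have E0: "E *\<^sub>v v = 0\<^sub>v n" if "v \<in> set (c3 @ c4 @ c5)" for v
  proof -
    have "v \<in> N" using that mem \<open>L \<subseteq> K\<close> \<open>K \<subseteq> N\<close> by auto
    then show ?thesis by (simp add: N_iff)
  qed
  have R0: "R *\<^sub>v v = 0\<^sub>v n" if "v \<in> set (c4 @ c5)" for v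
  proof -
    have "v \<in> K" using that mem \<open>L \<subseteq> K\<close> by auto
    then show ?thesis by (simp add: K_iff)
  qed
  have J0: "J *\<^sub>v v = 0\<^sub>v n" if "v \<in> set c5" for v
    using that mem(5) by (auto simp: L_iff)
  show thesis
    by (rule that[of c1 c2 c3 c4 c5]) (fact basis len E0 R0 JK4 J0 pd inv3 inv41)+
qed

section \<open>The block form\<close>

theorem corollary7p4:
  fixes n :: nat and E J R :: "real mat"
  assumes "dHDAE n E J R"
  shows "\<exists>Z. real_orthogonal_mat n Z \<and>
    (let E' = transpose_mat Z * E * Z;
         J' = transpose_mat Z * J * Z;
         R' = transpose_mat Z * R * Z
     in dHDAE n E' J' R' \<and>
        (\<forall>T z. (\<forall>t\<in>T. z t \<in> carrier_vec n) \<longrightarrow>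
           (dHDAE_solution n E J R T z \<longleftrightarrow>
            dHDAE_solution n E' J' R' T (\<lambda>t. transpose_mat Z *\<^sub>v z t))) \<and>
        (\<exists>n1 n2 n3 n4 n5. n1 + n2 + n3 + n4 + n5 = n \<and> n4 = n1 \<and>
          (let Eb = blk [n1, n2, n3, n4, n5] E';
               Jb = blk [n1, n2, n3, n4, n5] J';
               Rb = blk [n1, n2, n3, n4, n5] R'
           in E' = block_mat
                [[Eb 1 1, Eb 1 2, 0\<^sub>m n1 n3, 0\<^sub>m n1 n4, 0\<^sub>m n1 n5],
                 [Eb 2 1, Eb 2 2, 0\<^sub>m n2 n3, 0\<^sub>m n2 n4, 0\<^sub>m n2 n5],
                 [0\<^sub>m n3 n1, 0\<^sub>m n3 n2, 0\<^sub>m n3 n3, 0\<^sub>m n3 n4, 0\<^sub>m n3 n5],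
                 [0\<^sub>m n4 n1, 0\<^sub>m n4 n2, 0\<^sub>m n4 n3, 0\<^sub>m n4 n4, 0\<^sub>m n4 n5],
                 [0\<^sub>m n5 n1, 0\<^sub>m n5 n2, 0\<^sub>m n5 n3, 0\<^sub>m n5 n4, 0\<^sub>m n5 n5]] \<and>
              J' - R' = block_mat
                [[Jb 1 1 - Rb 1 1, Jb 1 2 - Rb 1 2, Jb 1 3 - Rb 1 3, Jb 1 4, 0\<^sub>m n1 n5],
                 [Jb 2 1 - Rb 2 1, Jb 2 2 - Rb 2 2, Jb 2 3 - Rb 2 3, 0\<^sub>m n2 n4, 0\<^sub>m n2 n5],
                 [Jb 3 1 - Rb 3 1, Jb 3 2 - Rb 3 2, Jb 3 3 - Rb 3 3, 0\<^sub>m n3 n4, 0\<^sub>m n3 n5],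
                 [Jb 4 1, 0\<^sub>m n4 n2, 0\<^sub>m n4 n3, 0\<^sub>m n4 n4, 0\<^sub>m n4 n5],
                 [0\<^sub>m n5 n1, 0\<^sub>m n5 n2, 0\<^sub>m n5 n3, 0\<^sub>m n5 n4, 0\<^sub>m n5 n5]] \<and>
              pd_mat (block_mat [[Eb 1 1, Eb 1 2], [Eb 2 1, Eb 2 2]]) \<and>
              invertible_mat (Jb 3 3 - Rb 3 3) \<and>
              Jb 4 1 = - transpose_mat (Jb 1 4) \<and>
              invertible_mat (Jb 4 1))))"
proof -
  have E: "E \<in> carrier_mat n n" "psd_mat E" and J: "J \<in> carrier_mat n n" "J = - transpose_mat J"
    and R: "R \<in> carrier_mat n n" "psd_mat R"
    using assms by (auto simp: dHDAE_def)
  obtain c1 c2 c3 c4 c5 where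
    basis: "orthonormal_basis n (carrier_vec n) (c1 @ c2 @ c3 @ c4 @ c5)"
    and len: "length c4 = length c1"
    and E0: "\<And>v. v \<in> set (c3 @ c4 @ c5) \<Longrightarrow> E *\<^sub>v v = 0\<^sub>v n"
    and R0: "\<And>v. v \<in> set (c4 @ c5) \<Longrightarrow> R *\<^sub>v v = 0\<^sub>v n"
    and J4: "\<And>u v. u \<in> set (c2 @ c3 @ c4 @ c5) \<Longrightarrow> v \<in> set c4 \<Longrightarrow> u \<bullet> (J *\<^sub>v v) = 0"
    and J5: "\<And>v. v \<in> set c5 \<Longrightarrow> J *\<^sub>v v = 0\<^sub>v n"
    and pd: "pd_mat (compression n (c1 @ c2) E (c1 @ c2))"
    and inv3: "invertible_mat (compression n c3 (J - R) c3)"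
    and inv4: "invertible_mat (compression n c4 J c1)"
    using dHDAE_adapted_basis[OF assms] by blast
  define css where "css = [c1, c2, c3, c4, c5]"
  define Z where "Z = mat_of_cols n (concat css)"
  define n1 n2 n3 n4 n5 where "n1 = length c1" and "n2 = length c2" and "n3 = length c3"
    and "n4 = length c4" and "n5 = length c5"
  note ns = n1_def n2_def n3_def n4_def n5_def
  have css: "set (concat css) \<subseteq> carrier_vec n"
    using basis by (simp add: css_def orthonormal_basis_def)
  then have c: "set c1 \<subseteq> carrier_vec n" "set c2 \<subseteq> carrier_vec n" "set c3 \<subseteq> carrier_vec n"
    "set c4 \<subseteq> carrier_vec n" "set c5 \<subseteq> carrier_vec n"
    by (simp_all add: css_def)
  have Z: "real_orthogonal_mat n Z" and n: "n1 + n2 + n3 + n4 + n5 = n"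
    using orthonormal_basis_carrier_orthogonal_mat[OF basis] by (simp_all add: Z_def css_def ns)
  have Zc: "Z \<in> carrier_mat n n" using Z by (simp add: real_orthogonal_mat_def)
  have Z_eq: "transpose_mat Z * A * Z = compression n (concat css) A (concat css)" for A
    by (simp add: Z_def compression_def)
  have blk: "blk [length c1, length c2, length c3, length c4, length c5] (transpose_mat Z * A * Z) i j
      = compression n (css ! (i - 1)) A (css ! (j - 1))"
    if "A \<in> carrier_mat n n" "1 \<le> i" "i \<le> 5" "1 \<le> j" "j \<le> 5" for A i j
    using blk_compression[OF that(1) css, of i j] that(2-) unfolding Z_eq by (simp add: css_def)
  have JR: "J - R \<in> carrier_mat n n" by (rule minus_carrier_mat[OF R(1)])
  have Z_minus: "transpose_mat Z * J * Z - transpose_mat Z * R * Z = transpose_mat Z * (J - R) * Z"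
    unfolding Z_eq using compression_minus[OF J(1) R(1)] by simp

  have R_sym: "v \<bullet> (R *\<^sub>v u) = 0"
    if "u \<in> carrier_vec n" "v \<in> carrier_vec n" "u \<bullet> (R *\<^sub>v v) = 0" for u v
    using scalar_prod_mult_mat_vec[OF R(1) that(1,2)] R that comm_scalar_prod[of "R *\<^sub>v u" n v]
    by (simp add: psd_mat_def)
  have E_sym: "v \<bullet> (E *\<^sub>v u) = 0"
    if "u \<in> carrier_vec n" "v \<in> carrier_vec n" "u \<bullet> (E *\<^sub>v v) = 0" for u v
    using scalar_prod_mult_mat_vec[OF E(1) that(1,2)] E that comm_scalar_prod[of "E *\<^sub>v u" n v]
    by (simp add: psd_mat_def)
  have J_skew: "v \<bullet> (J *\<^sub>v u) = 0"
    if "u \<in> carrier_vec n" "v \<in> carrier_vec n" "u \<bullet> (J *\<^sub>v v) = 0" for u v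
    using skew_scalar_prod[OF J that(2,1)] that(3) by simp
  \<comment> \<open>Zero blocks come in transposed pairs, as \<open>u \<bullet> A v\<close> is symmetric or antisymmetric in \<open>u\<close> and \<open>v\<close>.\<close>
  have zero: "compression n us A vs = 0\<^sub>m (length us) (length vs)"
    "compression n vs A us = 0\<^sub>m (length vs) (length us)"
    if "A \<in> carrier_mat n n" "set us \<subseteq> carrier_vec n" "set vs \<subseteq> carrier_vec n"
      "\<And>u v. u \<in> carrier_vec n \<Longrightarrow> v \<in> carrier_vec n \<Longrightarrow> u \<bullet> (A *\<^sub>v v) = 0 \<Longrightarrow> v \<bullet> (A *\<^sub>v u) = 0"
      "\<And>u v. u \<in> set us \<Longrightarrow> v \<in> set vs \<Longrightarrow> u \<bullet> (A *\<^sub>v v) = 0" for us vs A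
    using that by (intro compression_eq_0; blast)+
  have Ez: "compression n us E vs = 0\<^sub>m (length us) (length vs)"
    "compression n vs E us = 0\<^sub>m (length vs) (length us)"
    if "set us \<subseteq> carrier_vec n" "vs \<in> {c3, c4, c5}" for us vs
  proof -
    have vs: "set vs \<subseteq> carrier_vec n" "\<And>u v. u \<in> set us \<Longrightarrow> v \<in> set vs \<Longrightarrow> u \<bullet> (E *\<^sub>v v) = 0"
      using that c E0 by (auto simp: subset_iff)
    show "compression n us E vs = 0\<^sub>m (length us) (length vs)"
      by (rule zero(1)[OF E(1) that(1) vs(1)]) (fact E_sym vs(2))+
    show "compression n vs E us = 0\<^sub>m (length vs) (length us)"
      by (rule zero(2)[OF E(1) that(1) vs(1)]) (fact E_sym vs(2))+
  qed
  have Rz: "compression n us R vs = 0\<^sub>m (length us) (length vs)"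
    "compression n vs R us = 0\<^sub>m (length vs) (length us)"
    if "set us \<subseteq> carrier_vec n" "vs \<in> {c4, c5}" for us vs
  proof -
    have vs: "set vs \<subseteq> carrier_vec n" "\<And>u v. u \<in> set us \<Longrightarrow> v \<in> set vs \<Longrightarrow> u \<bullet> (R *\<^sub>v v) = 0"
      using that c R0 by (auto simp: subset_iff)
    show "compression n us R vs = 0\<^sub>m (length us) (length vs)"
      by (rule zero(1)[OF R(1) that(1) vs(1)]) (fact R_sym vs(2))+
    show "compression n vs R us = 0\<^sub>m (length vs) (length us)"
      by (rule zero(2)[OF R(1) that(1) vs(1)]) (fact R_sym vs(2))+
  qed
  have Jz: "compression n us J vs = 0\<^sub>m (length us) (length vs)"
    "compression n vs J us = 0\<^sub>m (length vs) (length us)"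
    if "set us \<subseteq> carrier_vec n" "vs = c5 \<or> vs = c4 \<and> us \<in> {c2, c3, c4, c5}" for us vs
  proof -
    have vs: "set vs \<subseteq> carrier_vec n" "\<And>u v. u \<in> set us \<Longrightarrow> v \<in> set vs \<Longrightarrow> u \<bullet> (J *\<^sub>v v) = 0"
      using that c J4 J5 by (auto simp: subset_iff)
    show "compression n us J vs = 0\<^sub>m (length us) (length vs)"
      by (rule zero(1)[OF J(1) that(1) vs(1)]) (fact J_skew vs(2))+
    show "compression n vs J us = 0\<^sub>m (length vs) (length us)"
      by (rule zero(2)[OF J(1) that(1) vs(1)]) (fact J_skew vs(2))+
  qed
  have minus_0: "A - 0\<^sub>m r k = A" if "A \<in> carrier_mat r k" for A :: "real mat" and r k
    using that by auto
  have carr: "transpose_mat Z * A * Z \<in> carrier_mat n n" if "A \<in> carrier_mat n n" for A :: "real mat"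
    using that Zc by simp
  have sol: "\<forall>T z. (\<forall>t\<in>T. z t \<in> carrier_vec n) \<longrightarrow>
       (dHDAE_solution n E J R T z \<longleftrightarrow>
        dHDAE_solution n (transpose_mat Z * E * Z) (transpose_mat Z * J * Z)
          (transpose_mat Z * R * Z) T (\<lambda>t. transpose_mat Z *\<^sub>v z t))"
    using dHDAE_solution_transform_iff[OF Z E(1) J(1) R(1)] by blast
  show ?thesis
    unfolding Let_def
  proof (rule exI[of _ Z], rule conjI[OF Z], rule conjI[OF dHDAE_congruence[OF assms Zc]],
      rule conjI[OF sol], rule exI[of _ n1], rule exI[of _ n2], rule exI[of _ n3],
      rule exI[of _ n4], rule exI[of _ n5], intro conjI)
    let ?E = "transpose_mat Z * E * Z" and ?J = "transpose_mat Z * J * Z"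
      and ?R = "transpose_mat Z * R * Z" and ?ns = "[n1, n2, n3, n4, n5]"
    show "n1 + n2 + n3 + n4 + n5 = n" by (fact n)
    show "n4 = n1" using len by (simp add: ns)
    show "?E = block_mat
                [[blk ?ns ?E 1 1, blk ?ns ?E 1 2, 0\<^sub>m n1 n3, 0\<^sub>m n1 n4, 0\<^sub>m n1 n5],
                 [blk ?ns ?E 2 1, blk ?ns ?E 2 2, 0\<^sub>m n2 n3, 0\<^sub>m n2 n4, 0\<^sub>m n2 n5],
                 [0\<^sub>m n3 n1, 0\<^sub>m n3 n2, 0\<^sub>m n3 n3, 0\<^sub>m n3 n4, 0\<^sub>m n3 n5],
                 [0\<^sub>m n4 n1, 0\<^sub>m n4 n2, 0\<^sub>m n4 n3, 0\<^sub>m n4 n4, 0\<^sub>m n4 n5],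
                 [0\<^sub>m n5 n1, 0\<^sub>m n5 n2, 0\<^sub>m n5 n3, 0\<^sub>m n5 n4, 0\<^sub>m n5 n5]]"
      by (subst block_mat_blk_5_5[OF carr[OF E(1)] n, symmetric]) (simp add: blk[OF E(1)] css_def Ez c ns)
    show "?J - ?R = block_mat
                [[blk ?ns ?J 1 1 - blk ?ns ?R 1 1, blk ?ns ?J 1 2 - blk ?ns ?R 1 2, blk ?ns ?J 1 3 - blk ?ns ?R 1 3, blk ?ns ?J 1 4, 0\<^sub>m n1 n5],
                 [blk ?ns ?J 2 1 - blk ?ns ?R 2 1, blk ?ns ?J 2 2 - blk ?ns ?R 2 2, blk ?ns ?J 2 3 - blk ?ns ?R 2 3, 0\<^sub>m n2 n4, 0\<^sub>m n2 n5],
                 [blk ?ns ?J 3 1 - blk ?ns ?R 3 1, blk ?ns ?J 3 2 - blk ?ns ?R 3 2, blk ?ns ?J 3 3 - blk ?ns ?R 3 3, 0\<^sub>m n3 n4, 0\<^sub>m n3 n5],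
                 [blk ?ns ?J 4 1, 0\<^sub>m n4 n2, 0\<^sub>m n4 n3, 0\<^sub>m n4 n4, 0\<^sub>m n4 n5],
                 [0\<^sub>m n5 n1, 0\<^sub>m n5 n2, 0\<^sub>m n5 n3, 0\<^sub>m n5 n4, 0\<^sub>m n5 n5]]"
      unfolding Z_minus
      by (subst block_mat_blk_5_5[OF carr[OF JR] n, symmetric])
        (simp add: blk[OF J(1)] blk[OF R(1)] blk[OF JR] compression_minus[OF J(1) R(1)] css_def Jz Rz c ns minus_0)
    show "pd_mat (block_mat [[blk ?ns ?E 1 1, blk ?ns ?E 1 2], [blk ?ns ?E 2 1, blk ?ns ?E 2 2]])"
      unfolding block_mat_blk_2_2 Z_eq using pd slice_compression[OF E(1) css, of "[]" "c1 @ c2" "c3 @ c4 @ c5" "[]" "c1 @ c2" "c3 @ c4 @ c5"]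
      by (simp add: css_def ns)
    show "invertible_mat (blk ?ns ?J 3 3 - blk ?ns ?R 3 3)"
      using inv3 by (simp add: ns blk[OF J(1)] blk[OF R(1)] css_def compression_minus[OF J(1) R(1)])
    show "blk ?ns ?J 4 1 = - transpose_mat (blk ?ns ?J 1 4)"
      using compression_skew[OF J c(4,1)] by (simp add: ns blk[OF J(1)] css_def)
    show "invertible_mat (blk ?ns ?J 4 1)"
      using inv4 by (simp add: ns blk[OF J(1)] css_def)
  qed
qed

end
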